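(* For any positive integer $\ell$, there are infinitely many even positive integers $k$ such that an optimal $(2k(k-1) + 2\ell,k,1)$-optical orthogonal code does not exist.
   Context: A $(v,k,1)$-optical orthogonal code ($(v,k,1)$-OOC) of size $n$ is a set $\mathcal{C}$ of $n$ $(0,1)$-vectors of length $v$, each of Hamming weight $k$, such that (with subscripts reduced modulo $v$): for every $\mathbf{x}=(x_0,\dots,x_{v-1}) \in \mathcal{C}$ and every integer $0<\tau<v$, $\sum_{i=0}^{v-1} x_i x_{i+\tau} \le 1$; and for all $\mathbf{x}\ne\mathbf{y}$ in $\mathcal{C}$ and every integer $0\le\tau<v$, $\sum_{i=0}^{v-1} x_i y_{i+\tau} \le 1$. The size of a $(v,k,1)$-OOC is always at most $\left\lfloor \frac{v-1}{k(k-1)} \right\rfloor$; it is called optimal if its size equals $\left\lfloor \frac{v-1}{k(k-1)} \right\rfloor$. *)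

theory Defs
  imports Complex_Main
begin

text \<open>A binary vector of length \<open>v\<close> is a list \<open>x :: nat list\<close> of length \<open>v\<close> with entries in
  \<open>{0, 1}\<close>; its coordinates are \<open>x ! 0, \<dots>, x ! (v - 1)\<close>.\<close>

definition binary_vectors :: "nat \<Rightarrow> nat list set" where
  "binary_vectors v = {x. length x = v \<and> set x \<subseteq> {0, 1}}"

definition hamming_weight :: "nat list \<Rightarrow> nat" where
  "hamming_weight x = card {i. i < length x \<and> x ! i \<noteq> 0}"

definition correlation :: "nat \<Rightarrow> nat list \<Rightarrow> nat list \<Rightarrow> nat \<Rightarrow> nat" where
  "correlation v x y \<tau> = (\<Sum>i<v. x ! i * y ! ((i + \<tau>) mod v))"

text \<open>\<open>is_ooc v k C\<close>: \<open>C\<close> is a \<open>(v, k, 1)\<close>-optical orthogonal code. Its size is \<open>card C\<close>;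
  \<open>C\<close> is finite, being a subset of the finite set \<open>binary_vectors v\<close>.\<close>

definition is_ooc :: "nat \<Rightarrow> nat \<Rightarrow> nat list set \<Rightarrow> bool" where
  "is_ooc v k C \<longleftrightarrow>
     C \<subseteq> binary_vectors v \<and>
     (\<forall>x\<in>C. hamming_weight x = k) \<and>
     (\<forall>x\<in>C. \<forall>\<tau>. 0 < \<tau> \<and> \<tau> < v \<longrightarrow> correlation v x x \<tau> \<le> 1) \<and>
     (\<forall>x\<in>C. \<forall>y\<in>C. x \<noteq> y \<longrightarrow> (\<forall>\<tau><v. correlation v x y \<tau> \<le> 1))"

definition is_optimal_ooc :: "nat \<Rightarrow> nat \<Rightarrow> nat list set \<Rightarrow> bool" where
  "is_optimal_ooc v k C \<longleftrightarrow>
     is_ooc v k C \<and>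
     int (card C) = \<lfloor>(real v - 1) / (real k * (real k - 1))\<rfloor>"

end

theory Submission
  imports Defs "HOL-Number_Theory.Number_Theory" "HOL-Library.Infinite_Set"
begin

text \<open>
  Put \<open>v = 2 k (k - 1) + 2 l\<close>. Once \<open>k > 2 l\<close>, an optimal code has exactly two codewords
  \<open>x\<close> and \<open>y\<close>. Their \<open>2 k (k - 1)\<close> internal differences are pairwise distinct and nonzero
  modulo \<open>v\<close>: a difference occurring in both words would produce a cross-correlation of at least
  2 (\<open>ooc_autocorrelations_disjoint\<close>). Hence all but \<open>2 l - 1\<close> of the nonzero residues occur.

  Since \<open>v\<close> is even, \<open>i \<mapsto> (- 1) ^ i\<close> is a character of the integers modulo \<open>v\<close>. If \<open>a\<close> and
  \<open>b\<close> are the alternating sums of the entries of \<open>x\<close> and \<open>y\<close>, evaluating that character on the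
  differences (\<open>weighted_sum_squared\<close>) expresses \<open>a\<^sup>2 + b\<^sup>2\<close> as \<open>2 k - 1\<close> minus a sum of
  \<open>2 l - 1\<close> signs. So some integer among \<open>2 k - 2 l, \<dots>, 2 k + 2 l - 2\<close> is a sum of two squares
  (\<open>two_word_ooc_sum_two_squares\<close>).

  On the other hand there are arbitrarily long and arbitrarily late runs of consecutive integers
  none of which is a sum of two squares (\<open>gap_in_sums_of_two_squares\<close>): by the Chinese remainder
  theorem the members of the run can be made exactly divisible by distinct primes congruent to
  3 modulo 4. Prescribing in addition the residue modulo 4 of the first member makes \<open>k\<close> even.
\<close>

section \<open>Gaps between sums of two squares\<close>

lemma ex_prime_factor_3_mod_4:
  fixes n :: nat
  assumes "n mod 4 = 3"
  shows "\<exists>p. prime p \<and> p dvd n \<and> p mod 4 = 3"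
  using assms
proof (induction n rule: less_induct)
  case (less n)
  have "n \<noteq> 1" using less.prems by auto
  then obtain p where p: "prime p" "p dvd n"
    using prime_factor_nat by blast
  then obtain m where m: "n = p * m" by (elim dvdE)
  show ?case
  proof (cases "p mod 4 = 3")
    case True
    with p show ?thesis by blast
  next
    case False
    have prod: "(p mod 4) * (m mod 4) mod 4 = 3"
      using less.prems m by (simp add: mod_mult_eq)
    have "p mod 4 \<in> {0, 1, 2, 3}" "m mod 4 \<in> {0, 1, 2, 3}"
      by auto
    with prod False have "m mod 4 = 3" by (elim insertE emptyE) simp_all
    moreover have "m < n"
    proof -
      have "0 < m" using less.prems m by (intro gr0I) simp
      then have "1 * m < p * m"
        using prime_gt_1_nat[OF p(1)] by (intro mult_strict_right_mono)
      then show ?thesis using m by simp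
    qed
    ultimately obtain q where "prime q" "q dvd m" "q mod 4 = 3"
      using less.IH by blast
    then show ?thesis unfolding m by (blast intro: dvd_mult)
  qed
qed

lemma infinite_primes_3_mod_4: "infinite {p :: nat. prime p \<and> p mod 4 = 3}"
  unfolding infinite_nat_iff_unbounded
proof
  fix n :: nat
  define N :: nat where "N = 4 * fact n - 1"
  have "(fact n :: nat) \<ge> 1" by (rule fact_ge_1)
  then obtain f where f: "(fact n :: nat) = Suc f" by (cases "fact n :: nat") auto
  have "N mod 4 = 3"
    unfolding N_def f by (simp add: mod_simps)
  then obtain p where p: "prime p" "p dvd N" "p mod 4 = 3"
    using ex_prime_factor_3_mod_4 by blast
  have "n < p"
  proof (rule ccontr)
    assume "\<not> n < p"
    then have "p dvd fact n"
      using p(1) prime_dvd_fact_iff by auto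
    then have "p dvd 4 * fact n - N"
      using p(2) by (intro dvd_diff_nat) auto
    moreover have "4 * fact n - N = 1"
      unfolding N_def f by simp
    ultimately show False
      using p(1) by (metis not_prime_unit)
  qed
  with p show "\<exists>p>n. p \<in> {p. prime p \<and> p mod 4 = 3}" by blast
qed

lemma prime_3_mod_4_dvd_sum_squares:
  fixes p :: nat and a b :: int
  assumes p: "prime p" "p mod 4 = 3" and dvd: "int p dvd a\<^sup>2 + b\<^sup>2"
  shows "int p dvd a"
proof (rule ccontr)
  assume na: "\<not> int p dvd a"
  have pi: "prime (int p)" using p by simp
  have nb: "\<not> int p dvd b"
  proof
    assume "int p dvd b"
    then have "int p dvd b\<^sup>2" by (simp add: power2_eq_square)
    then have "int p dvd a\<^sup>2" using dvd by (metis dvd_add_left_iff)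
    then show False using na pi prime_dvd_power by blast
  qed
  define m where "m = (p - 1) div 2"
  have m: "p - 1 = 2 * m" "odd m"
    using p(2) unfolding m_def by presburger+
  have fermat: "[c ^ (p - 1) = 1] (mod int p)" if c: "\<not> int p dvd c" for c :: int
  proof -
    have "\<not> p dvd nat \<bar>c\<bar>" using c by (simp add: dvd_nat_abs_iff)
    then have "[nat \<bar>c\<bar> ^ (p - 1) = 1] (mod p)"
      by (rule fermat_theorem[OF p(1)])
    then have "[int (nat \<bar>c\<bar> ^ (p - 1)) = int 1] (mod int p)"
      by (simp only: cong_int_iff)
    moreover have "int (nat \<bar>c\<bar> ^ (p - 1)) = c ^ (p - 1)"
      unfolding m(1) power_mult by (simp add: power_abs)
    ultimately show ?thesis by simp
  qed
  have "[a\<^sup>2 = - (b\<^sup>2)] (mod int p)"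
    using dvd by (simp add: cong_iff_dvd_diff)
  \<comment> \<open>As \<open>m = (p - 1) / 2\<close> is odd, the sign survives the \<open>m\<close>-th power and contradicts
      Fermat's little theorem.\<close>
  then have "[(a\<^sup>2) ^ m = (- (b\<^sup>2)) ^ m] (mod int p)"
    by (rule cong_pow)
  then have "[a ^ (p - 1) = - (b ^ (p - 1))] (mod int p)"
    using m by (simp add: power_mult)
  then have "[1 = - (1 :: int)] (mod int p)"
    using fermat[OF na] fermat[OF nb] by (meson cong_minus_minus_iff cong_sym cong_trans)
  then have "int p dvd 2" by (simp add: cong_iff_dvd_diff)
  then have "p dvd 2" by presburger
  then have "p \<le> 2" by (rule dvd_imp_le) simp
  then show False using p(2) by (cases "p = 0 \<or> p = 1 \<or> p = 2") auto
qed

lemma cong_prime_not_sum_two_squares: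
  fixes p n :: nat and a b :: int
  assumes p: "prime p" "p mod 4 = 3" and n: "[n = p] (mod p\<^sup>2)"
  shows "a\<^sup>2 + b\<^sup>2 \<noteq> int n"
proof
  assume eq: "a\<^sup>2 + b\<^sup>2 = int n"
  have "[n = p] (mod p)"
    using n by (rule cong_modulus_mult_nat[of _ _ p p, folded power2_eq_square])
  then have "p dvd n" by (simp add: cong_dvd_iff)
  then have "int p dvd a\<^sup>2 + b\<^sup>2" "int p dvd b\<^sup>2 + a\<^sup>2"
    using eq by (simp_all add: add.commute)
  then have "int p dvd a" "int p dvd b"
    using prime_3_mod_4_dvd_sum_squares[OF p] by blast+
  then have "(int p)\<^sup>2 dvd a\<^sup>2 + b\<^sup>2"
    by (intro dvd_add) (auto simp: dvd_power_same)
  then have "int (p\<^sup>2) dvd int n" using eq by simp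
  then have "p\<^sup>2 dvd n" by (simp only: of_nat_dvd_iff)
  then have "p\<^sup>2 dvd p" using n by (simp add: cong_dvd_iff)
  then have "p * p \<le> p"
    using prime_gt_0_nat[OF p(1)] by (intro dvd_imp_le) (auto simp: power2_eq_square)
  then show False using prime_gt_1_nat[OF p(1)] by simp
qed

lemma gap_in_sums_of_two_squares:
  fixes B n r :: nat
  assumes "n > 0"
  shows "\<exists>M>B. [M = r] (mod 4) \<and> (\<forall>i<n. \<forall>a b :: int. a\<^sup>2 + b\<^sup>2 \<noteq> int (M + i))"
proof -
  define S where "S = {p :: nat. prime p \<and> p mod 4 = 3} - {..B}"
  have S: "infinite S"
    unfolding S_def using infinite_primes_3_mod_4 by (intro Diff_infinite_finite) auto
  define p where "p = enumerate S"
  have pS: "p i \<in> S" for i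
    unfolding p_def using S by (rule enumerate_in_set)
  have p: "prime (p i)" "p i mod 4 = 3" "p i > B" for i
    using pS[of i] unfolding S_def by auto
  have inj: "inj p"
    unfolding p_def using S by (rule inj_enumerate)
  \<comment> \<open>Index \<open>n\<close> carries the extra congruence modulo 4. The residue \<open>p i + i * ((p i)\<^sup>2 - 1)\<close> is
      \<open>p i - i\<close> modulo \<open>(p i)\<^sup>2\<close>, written without subtracting \<open>i\<close> on the naturals.\<close>
  define m where "m i = (if i < n then (p i)\<^sup>2 else 4)" for i
  define u where "u i = (if i < n then p i + i * ((p i)\<^sup>2 - 1) else r)" for i
  have cop4: "coprime ((p i)\<^sup>2) 4" for i
  proof -
    have "odd (p i)" using p(2)[of i] by presburger
    then have "coprime ((p i)\<^sup>2) (2\<^sup>2)"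
      by (intro coprime_power_left_iff[THEN iffD2] coprime_power_right_iff[THEN iffD2] disjI1) simp
    then show ?thesis by simp
  qed
  have cop: "coprime (m i) (m j)" if "i \<le> n" "j \<le> n" "i \<noteq> j" for i j
  proof -
    have "p i \<noteq> p j" using inj that by (auto dest: injD)
    then have "coprime (p i) (p j)" using p(1) by (simp add: primes_coprime)
    then have "coprime ((p i)\<^sup>2) ((p j)\<^sup>2)" by simp
    then show ?thesis
      using that cop4[of i] cop4[of j] unfolding m_def by (auto simp: coprime_commute)
  qed
  have "\<exists>M. \<forall>i\<in>{..n}. [M = u i] (mod m i)"
    by (rule chinese_remainder_nat) (use cop in auto)
  then obtain M where M: "\<And>i. i \<le> n \<Longrightarrow> [M = u i] (mod m i)" by auto
  have run: "[M + i = p i] (mod (p i)\<^sup>2)" if i: "i < n" for i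
  proof -
    have "[M + i = u i + i] (mod (p i)\<^sup>2)"
      using M[of i] i by (intro cong_add) (auto simp: m_def)
    also have "u i + i = p i + i * (p i)\<^sup>2"
    proof -
      have "(p i)\<^sup>2 \<ge> 1" using prime_gt_0_nat[OF p(1), of i] by simp
      then obtain q where "(p i)\<^sup>2 = Suc q" by (cases "(p i)\<^sup>2") auto
      then show ?thesis using i unfolding u_def by (simp add: algebra_simps)
    qed
    also have "[\<dots> = p i] (mod (p i)\<^sup>2)" by (simp add: cong_def)
    finally show ?thesis .
  qed
  \<comment> \<open>A number congruent to \<open>p 0\<close> modulo \<open>(p 0)\<^sup>2\<close> is at least \<open>p 0\<close>, so large primes make \<open>M\<close> large.\<close>
  have "p 0 \<le> M"
  proof -
    have "p 0 < (p 0)\<^sup>2"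
      using prime_gt_1_nat[OF p(1), of 0] by (simp add: power2_eq_square)
    then have "M mod (p 0)\<^sup>2 = p 0"
      using run[OF assms] by (simp add: cong_def)
    then show ?thesis by (metis mod_less_eq_dividend)
  qed
  then have "M > B" using p(3)[of 0] by simp
  moreover have "[M = r] (mod 4)" using M[of n] by (simp add: m_def u_def)
  moreover have "a\<^sup>2 + b\<^sup>2 \<noteq> int (M + i)" if "i < n" for i and a b :: int
    using p(1,2) run[OF that] by (rule cong_prime_not_sum_two_squares)
  ultimately show ?thesis by blast
qed

section \<open>Correlations and alternating sums\<close>

lemma binary_nth:
  assumes "x \<in> binary_vectors v" "i < v"
  shows "x ! i = 0 \<or> x ! i = 1"
proof -
  have "x ! i \<in> set x" "set x \<subseteq> {0, 1}"
    using assms unfolding binary_vectors_def by auto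
  then show ?thesis by blast
qed

lemma sum_entries_eq_weight:
  assumes "x \<in> binary_vectors v"
  shows "(\<Sum>i<v. x ! i) = hamming_weight x"
proof -
  have "(\<Sum>i<v. x ! i) = (\<Sum>i<v. if x ! i \<noteq> 0 then 1 else 0)"
    using binary_nth[OF assms] by (intro sum.cong) fastforce+
  also have "\<dots> = card {i. i < v \<and> x ! i \<noteq> 0}"
    by (simp flip: sum.inter_filter)
  finally show ?thesis
    using assms unfolding hamming_weight_def binary_vectors_def by simp
qed

lemma correlation_0:
  assumes "x \<in> binary_vectors v"
  shows "correlation v x x 0 = hamming_weight x"
proof -
  have "correlation v x x 0 = (\<Sum>i<v. x ! i)"
    unfolding correlation_def using binary_nth[OF assms] by (intro sum.cong) fastforce+
  then show ?thesis using sum_entries_eq_weight[OF assms] by simp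
qed

lemma bij_betw_rotate:
  fixes v i :: nat
  shows "bij_betw (\<lambda>t. (i + t) mod v) {..<v} {..<v}"
proof -
  have "inj_on (\<lambda>t. (i + t) mod v) {..<v}"
  proof (rule inj_onI)
    fix s t assume "s \<in> {..<v}" "t \<in> {..<v}" "(i + s) mod v = (i + t) mod v"
    then show "s = t"
      using cong_add_lcancel_nat[of i s t v] by (simp add: cong_def)
  qed
  moreover have "(\<lambda>t. (i + t) mod v) ` {..<v} \<subseteq> {..<v}" by auto
  ultimately show ?thesis
    by (simp add: bij_betw_def endo_inj_surj)
qed

text \<open>The hypotheses on \<open>e\<close> say that \<open>i \<mapsto> e ^ i\<close> is a real-valued character of the integers
  modulo \<open>v\<close>; the square of a character sum is then the character sum of the autocorrelation.\<close>

lemma weighted_sum_squared: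
  fixes e :: int
  assumes e2: "e\<^sup>2 = 1" and ev: "e ^ v = 1"
  shows "(\<Sum>i<v. e ^ i * int (x ! i))\<^sup>2 = (\<Sum>t<v. e ^ t * int (correlation v x x t))"
proof -
  have per: "e ^ (n mod v) = e ^ n" for n
  proof -
    have "e ^ n = e ^ (v * (n div v) + n mod v)" by simp
    also have "\<dots> = e ^ (n mod v)" unfolding power_add power_mult ev by simp
    finally show ?thesis by simp
  qed
  have sq: "e ^ i * e ^ (i + t) = e ^ t" for i t
  proof -
    have "e ^ i * e ^ (i + t) = (e\<^sup>2) ^ i * e ^ t"
      by (simp add: power_add power_mult[symmetric] mult_2)
    then show ?thesis using e2 by simp
  qed
  have "(\<Sum>i<v. e ^ i * int (x ! i))\<^sup>2
      = (\<Sum>i<v. e ^ i * int (x ! i) * (\<Sum>j<v. e ^ j * int (x ! j)))"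
    by (simp add: power2_eq_square sum_distrib_right)
  also have "\<dots> = (\<Sum>i<v. e ^ i * int (x ! i) *
      (\<Sum>t<v. e ^ ((i + t) mod v) * int (x ! ((i + t) mod v))))"
    by (subst sum.reindex_bij_betw[OF bij_betw_rotate]) simp
  also have "\<dots> = (\<Sum>i<v. \<Sum>t<v. e ^ t * (int (x ! i) * int (x ! ((i + t) mod v))))"
    unfolding per sum_distrib_left
  proof (intro sum.cong refl)
    fix i t
    show "e ^ i * int (x ! i) * (e ^ (i + t) * int (x ! ((i + t) mod v)))
        = e ^ t * (int (x ! i) * int (x ! ((i + t) mod v)))"
      unfolding sq[of i t, symmetric] by (simp add: mult_ac)
  qed
  also have "\<dots> = (\<Sum>t<v. \<Sum>i<v. e ^ t * (int (x ! i) * int (x ! ((i + t) mod v))))"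
    by (rule sum.swap)
  also have "\<dots> = (\<Sum>t<v. e ^ t * int (correlation v x x t))"
    by (simp add: correlation_def sum_distrib_left)
  finally show ?thesis .
qed

lemma sum_correlation:
  assumes "x \<in> binary_vectors v"
  shows "(\<Sum>t<v. int (correlation v x x t)) = (int (hamming_weight x))\<^sup>2"
proof -
  have "(\<Sum>i<v. int (x ! i)) = int (hamming_weight x)"
    using sum_entries_eq_weight[OF assms] by (metis of_nat_sum)
  then show ?thesis using weighted_sum_squared[of 1 v x] by simp
qed

section \<open>Codes with two codewords\<close>

lemma ooc_autocorrelations_disjoint:
  assumes C: "is_ooc v k C" and xy: "x \<in> C" "y \<in> C" "x \<noteq> y" and t: "0 < t" "t < v"
  shows "correlation v x x t = 0 \<or> correlation v y y t = 0"
proof (rule ccontr)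
  assume "\<not> ?thesis"
  then have nz: "correlation v x x t \<noteq> 0" "correlation v y y t \<noteq> 0" by auto
  obtain i where i: "i < v" "x ! i \<noteq> 0" "x ! ((i + t) mod v) \<noteq> 0"
    using nz(1) unfolding correlation_def by auto
  obtain j where j: "j < v" "y ! j \<noteq> 0" "y ! ((j + t) mod v) \<noteq> 0"
    using nz(2) unfolding correlation_def by auto
  \<comment> \<open>The shift by \<open>d = j - i\<close> carries \<open>i\<close> to \<open>j\<close> and \<open>i + t\<close> to \<open>j + t\<close>.\<close>
  define d where "d = (j + (v - i)) mod v"
  define i' where "i' = (i + t) mod v"
  have d: "d < v" and i': "i' < v" using t unfolding d_def i'_def by auto
  have id: "(i + d) mod v = j"
  proof -
    have "(i + d) mod v = (i + (j + (v - i))) mod v" unfolding d_def by (simp add: mod_simps)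
    also have "i + (j + (v - i)) = j + v" using i by simp
    finally show ?thesis using j by simp
  qed
  have i'd: "(i' + d) mod v = (j + t) mod v"
  proof -
    have "(i' + d) mod v = ((i + d) mod v + t) mod v"
      unfolding i'_def by (simp add: mod_simps add_ac)
    then show ?thesis unfolding id .
  qed
  have "i \<noteq> i'"
  proof
    assume "i = i'"
    then have "[i + t = i + 0] (mod v)" using i unfolding i'_def cong_def by simp
    then have "[t = 0] (mod v)" by (simp only: cong_add_lcancel_nat)
    then show False using t by (simp add: cong_def)
  qed
  let ?f = "\<lambda>n. x ! n * y ! ((n + d) mod v)"
  have "sum ?f {i, i'} \<le> correlation v x y d"
    unfolding correlation_def using i i' by (intro sum_mono2) auto
  moreover have "sum ?f {i, i'} = ?f i + ?f i'" using \<open>i \<noteq> i'\<close> by simp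
  moreover have "?f i \<ge> 1" "?f i' \<ge> 1"
    using i j unfolding id i'd by (simp_all add: i'_def Suc_le_eq)
  moreover have "correlation v x y d \<le> 1"
    using C xy d unfolding is_ooc_def by blast
  ultimately show False by linarith
qed

text \<open>In the conclusion \<open>int v - 1 - 2 k (k - 1)\<close> is the number of nonzero residues modulo \<open>v\<close> that
  are not a difference of two positions in the same codeword.\<close>

lemma two_word_ooc_sum_two_squares:
  assumes C: "is_ooc v k C" and xy: "x \<in> C" "y \<in> C" "x \<noteq> y" and v: "even v" "v > 0"
  shows "\<exists>a b :: int. \<bar>2 * int k - 1 - (a\<^sup>2 + b\<^sup>2)\<bar> \<le> int v - 1 - 2 * (int k * (int k - 1))"
proof -
  have bin: "x \<in> binary_vectors v" "y \<in> binary_vectors v"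
    and wt: "hamming_weight x = k" "hamming_weight y = k"
    using C xy unfolding is_ooc_def by auto
  define T where "T t = int (correlation v x x t) + int (correlation v y y t)" for t
  define a b :: int where
    "a = (\<Sum>i<v. (-1) ^ i * int (x ! i))" and "b = (\<Sum>i<v. (-1) ^ i * int (y ! i))"
  have split0: "sum f {..<v} = f 0 + sum f {1..<v}" for f :: "nat \<Rightarrow> int"
    using v(2) by (metis One_nat_def lessThan_atLeast0 sum.atLeast_Suc_lessThan)
  have T0: "T 0 = 2 * int k"
    unfolding T_def using correlation_0[OF bin(1)] correlation_0[OF bin(2)] wt by simp
  have T1: "T t \<le> 1" if "t \<in> {1..<v}" for t
  proof -
    have "correlation v x x t \<le> 1" "correlation v y y t \<le> 1"
      using C xy that unfolding is_ooc_def by auto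
    moreover have "correlation v x x t = 0 \<or> correlation v y y t = 0"
      using ooc_autocorrelations_disjoint[OF C xy] that by auto
    ultimately show ?thesis unfolding T_def by auto
  qed
  have "(\<Sum>t<v. T t) = 2 * (int k)\<^sup>2"
    unfolding T_def sum.distrib sum_correlation[OF bin(1)] sum_correlation[OF bin(2)] wt by simp
  then have sumT: "(\<Sum>t=1..<v. T t) = 2 * (int k * (int k - 1))"
    unfolding split0 T0 by (simp add: power2_eq_square algebra_simps)
  have missing: "(\<Sum>t=1..<v. 1 - T t) = int v - 1 - 2 * (int k * (int k - 1))"
    using v(2) unfolding sum_subtractf sumT by (simp add: of_nat_diff)
  have "a\<^sup>2 + b\<^sup>2 = (\<Sum>t<v. (-1) ^ t * T t)"
    using weighted_sum_squared[of "-1" v x] weighted_sum_squared[of "-1" v y] v(1)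
    unfolding a_def b_def T_def by (simp add: sum.distrib distrib_left)
  then have ab: "a\<^sup>2 + b\<^sup>2 = 2 * int k + (\<Sum>t=1..<v. (-1) ^ t * T t)"
    unfolding split0 T0 by simp
  have "(\<Sum>t<2 * n. (-1 :: int) ^ t) = 0" for n :: nat
    by (induction n) auto
  then have "(\<Sum>t<v. (-1 :: int) ^ t) = 0" using v(1) by (metis evenE)
  then have "(\<Sum>t=1..<v. (-1 :: int) ^ t) = -1" unfolding split0 by simp
  then have "2 * int k - 1 - (a\<^sup>2 + b\<^sup>2) = (\<Sum>t=1..<v. (-1) ^ t * (1 - T t))"
    unfolding ab by (simp add: right_diff_distrib sum_subtractf)
  also have "\<bar>\<dots>\<bar> \<le> (\<Sum>t=1..<v. \<bar>(-1) ^ t * (1 - T t)\<bar>)"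
    by (rule sum_abs)
  also have "\<dots> = (\<Sum>t=1..<v. 1 - T t)"
    using T1 by (intro sum.cong) (auto simp: abs_mult power_abs)
  finally show ?thesis unfolding missing by blast
qed

lemma optimal_ooc_card:
  fixes k l :: nat
  assumes opt: "is_optimal_ooc (2 * k * (k - 1) + 2 * l) k C" and l: "l > 0" and k: "k > 2 * l"
  shows "card C = 2"
proof -
  define q where "q = real k * (real k - 1)"
  have v: "real (2 * k * (k - 1) + 2 * l) - 1 = 2 * q + (2 * real l - 1)"
    using k by (simp add: q_def of_nat_diff)
  have "real k \<ge> 2 * real l + 1" using k by linarith
  then have "1 * (2 * real l) \<le> q"
    unfolding q_def using l by (intro mult_mono) auto
  then have q: "2 * real l - 1 < q" "q > 0" using l by auto
  have "\<lfloor>(2 * q + (2 * real l - 1)) / q\<rfloor> = 2"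
    using q l by (intro floor_unique) (auto simp: field_simps)
  then have "int (card C) = 2"
    using opt unfolding is_optimal_ooc_def v q_def by simp
  then show ?thesis by simp
qed

theorem theorem4p9:
  fixes l :: nat
  assumes "l > 0"
  shows "infinite {k :: nat. k > 0 \<and> even k \<and>
           \<not> (\<exists>C. is_optimal_ooc (2 * k * (k - 1) + 2 * l) k C)}"
  unfolding infinite_nat_iff_unbounded
proof
  fix n :: nat
  \<comment> \<open>The run \<open>M, \<dots>, M + 4 l - 2\<close> is to be \<open>2 k - 2 l, \<dots>, 2 k + 2 l - 2\<close>, and \<open>k\<close> is even because
      \<open>M + 2 l\<close> is divisible by 4.\<close>
  obtain M where M: "M > 2 * n + 4 * l" "[M = 2 * l] (mod 4)"
    and gap: "\<And>i a b. i < 4 * l - 1 \<Longrightarrow> (a :: int)\<^sup>2 + b\<^sup>2 \<noteq> int (M + i)"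
    using gap_in_sums_of_two_squares[of "4 * l - 1" "2 * n + 4 * l" "2 * l"] assms by auto
  have "4 dvd M + 2 * l" using M(2) unfolding cong_def by presburger
  then obtain h where h: "M + 2 * l = 4 * h" by (elim dvdE)
  define k where "k = 2 * h"
  have k: "2 * k = M + 2 * l" "even k" using h unfolding k_def by auto
  have big: "k > n" "k > 2 * l" using M(1) k(1) by linarith+
  have "\<not> is_optimal_ooc (2 * k * (k - 1) + 2 * l) k C" for C
  proof
    assume opt: "is_optimal_ooc (2 * k * (k - 1) + 2 * l) k C"
    obtain x y where xy: "x \<in> C" "y \<in> C" "x \<noteq> y"
      using optimal_ooc_card[OF opt assms big(2)] by (auto simp: card_2_iff)
    have ooc: "is_ooc (2 * k * (k - 1) + 2 * l) k C"
      using opt unfolding is_optimal_ooc_def by blast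
    have v: "int (2 * k * (k - 1) + 2 * l) - 1 - 2 * (int k * (int k - 1)) = 2 * int l - 1"
      using big by (simp add: of_nat_diff)
    obtain a b :: int where ab: "\<bar>2 * int k - 1 - (a\<^sup>2 + b\<^sup>2)\<bar> \<le> 2 * int l - 1"
      using two_word_ooc_sum_two_squares[OF ooc xy] assms unfolding v by auto
    define i where "i = nat (a\<^sup>2 + b\<^sup>2 - int M)"
    have "a\<^sup>2 + b\<^sup>2 \<ge> int M" "a\<^sup>2 + b\<^sup>2 \<le> int M + 4 * int l - 2"
      using ab k(1) by linarith+
    then have "a\<^sup>2 + b\<^sup>2 = int (M + i)" "i < 4 * l - 1"
      using assms unfolding i_def by linarith+
    then show False using gap by blast
  qed
  then show "\<exists>m>n. m \<in> {k. k > 0 \<and> even k \<and>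
      \<not> (\<exists>C. is_optimal_ooc (2 * k * (k - 1) + 2 * l) k C)}"
    using big k(2) by (intro exI[of _ k]) auto
qed

end
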